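(* Let $X,Y$ be finite nonempty sets. For every (total or partial) Boolean function $f:X\times Y\rightarrow\{0,1\}$, $$C(f)=\lceil \log_2(k_f+1)\rceil ,$$ where $C(f)$ is the unbounded-error one-way classical communication complexity of $f$ and $k_f$ is the smallest dimension of an arrangement of points and hyperplanes realizing $f$.
   Context: A partial Boolean function $f:X\times Y\to\{0,1\}$ is defined only on a subset $\mathrm{dom}(f)\subseteq X\times Y$; it is total if $\mathrm{dom}(f)=X\times Y$. One-way classical protocol with cost $n$ (an integer $n\ge 0$) for $f$ (Alice holds $x$, Bob holds $y$, no shared randomness): for each $x\in X$ a probability distribution $q_x$ on $\{0,1\}^n$ (Alice's message to Bob), and for each $y\in Y$ and message $s\in\{0,1\}^n$ a number $l_y(s)\in[0,1]$, the probability that Bob outputs $0$ on receiving $s$. Bob outputs $0$ with probability $\sum_s q_x(s)l_y(s)$ and $1$ otherwise. The protocol computes $f$ (unbounded-error) if for every $(x,y)\in\mathrm{dom}(f)$ Bob outputs $f(x,y)$ with probability strictly larger than $1/2$. $C(f)$ is the minimum cost $n$ of such a protocol computing $f$. Arrangements: for an integer $k\ge 0$, a point is a vector $\mathbf p=(p_1,\dots,p_k)\in\mathbb R^k$, and a hyperplane in $\mathbb{R}^k$ is encoded by a real vector $\mathbf h=(h_1,\dots,h_k,h_{k+1})\in\mathbb R^{k+1}$ (representing $\{a\in\mathbb R^k: \sum_{i=1}^k a_ih_i=h_{k+1}\}$; any real vector is allowed). Put $\delta(\mathbf p,\mathbf h)=\mathrm{sign}\left(\sum_{i=1}^k p_ih_i-h_{k+1}\right)$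 with $\mathrm{sign}(a)=1,-1,0$ for $a>0$, $a<0$, $a=0$. A $k$-dimensional arrangement of points $(\mathbf p_x)_{x\in X}$ in $\mathbb R^k$ and hyperplanes $(\mathbf h_y)_{y\in Y}$ in $\mathbb R^{k+1}$ realizes $f$ if $\delta(\mathbf p_x,\mathbf h_y)=(-1)^{f(x,y)}$ for all $(x,y)\in\mathrm{dom}(f)$. $k_f$ is the smallest $k$ for which such an arrangement exists. *)

theory Defs
  imports "HOL-Probability.Probability_Mass_Function"
begin

(* A partial Boolean function on X * Y is a map f :: 'a * 'b \<rightharpoonup> bool with
   dom f \<subseteq> X * Y, where False stands for 0 and True for 1; f is total iff dom f = X * Y. *)

definition messages :: "nat \<Rightarrow> bool list set" where
  "messages n = {s. length s = n}"

definition is_protocol ::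
    "'a set \<Rightarrow> 'b set \<Rightarrow> nat \<Rightarrow> ('a \<Rightarrow> bool list pmf) \<Rightarrow> ('b \<Rightarrow> bool list \<Rightarrow> real) \<Rightarrow> bool" where
  "is_protocol X Y n q l \<longleftrightarrow>
     (\<forall>x\<in>X. set_pmf (q x) \<subseteq> messages n) \<and>
     (\<forall>y\<in>Y. \<forall>s\<in>messages n. 0 \<le> l y s \<and> l y s \<le> 1)"

(* l y s is the probability that Bob outputs 0 on receiving s. *)
definition output_prob ::
    "nat \<Rightarrow> ('a \<Rightarrow> bool list pmf) \<Rightarrow> ('b \<Rightarrow> bool list \<Rightarrow> real) \<Rightarrow> 'a \<Rightarrow> 'b \<Rightarrow> bool \<Rightarrow> real" where
  "output_prob n q l x y b =
     (let p0 = (\<Sum>s\<in>messages n. pmf (q x) s * l y s) in if b then 1 - p0 else p0)"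

definition computes ::
    "nat \<Rightarrow> ('a \<Rightarrow> bool list pmf) \<Rightarrow> ('b \<Rightarrow> bool list \<Rightarrow> real) \<Rightarrow> ('a \<times> 'b \<rightharpoonup> bool) \<Rightarrow> bool" where
  "computes n q l f \<longleftrightarrow>
     (\<forall>x y. (x, y) \<in> dom f \<longrightarrow> output_prob n q l x y (the (f (x, y))) > 1 / 2)"

definition unbounded_error_cc ::
    "'a set \<Rightarrow> 'b set \<Rightarrow> ('a \<times> 'b \<rightharpoonup> bool) \<Rightarrow> nat" where
  "unbounded_error_cc X Y f = (LEAST n. \<exists>q l. is_protocol X Y n q l \<and> computes n q l f)"

(* The dimension k varies, so vectors in R^k and R^(k+1) are functions nat => real of which
   only the coordinates 1..k and 1..k+1, respectively, are used. *)
definition side :: "nat \<Rightarrow> (nat \<Rightarrow> real) \<Rightarrow> (nat \<Rightarrow> real) \<Rightarrow> real" where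
  "side k p h = sgn ((\<Sum>i=1..k. p i * h i) - h (k + 1))"

(* Vectors p x with x outside X and h y with y outside Y are irrelevant when
   dom f \<subseteq> X * Y, so the families are indexed by the whole types. *)
definition realizes ::
    "nat \<Rightarrow> ('a \<Rightarrow> nat \<Rightarrow> real) \<Rightarrow> ('b \<Rightarrow> nat \<Rightarrow> real) \<Rightarrow> ('a \<times> 'b \<rightharpoonup> bool) \<Rightarrow> bool" where
  "realizes k p h f \<longleftrightarrow>
     (\<forall>x y. (x, y) \<in> dom f \<longrightarrow> side k (p x) (h y) = (-1) ^ of_bool (the (f (x, y))))"

definition arrangement_dim :: "('a \<times> 'b \<rightharpoonup> bool) \<Rightarrow> nat" where
  "arrangement_dim f = (LEAST k. \<exists>p h. realizes k p h f)"

(* The two minima are over nonempty sets, so LEAST is meaningful. *)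

lemma ex_protocol:
  fixes f :: "'a \<times> 'b \<rightharpoonup> bool"
  assumes "finite X" and "dom f \<subseteq> X \<times> Y"
  shows "\<exists>n q l. is_protocol X Y n q l \<and> computes n q l f"
proof -
  obtain e :: "'a \<Rightarrow> nat" where e: "bij_betw e X {0..<card X}"
    using assms(1) ex_bij_betw_finite_nat by blast
  define n where "n = card X"
  define m where "m x = map (\<lambda>i. i = e x) [0..<n]" for x
  define g where "g y s = (if \<exists>x\<in>X. m x = s \<and> f (x, y) = Some True then 0 else 1 :: real)" for y s
  have inj: "x = x'" if "x \<in> X" "x' \<in> X" "m x = m x'" for x x'
  proof -
    have "e x < n" using e that by (auto simp: bij_betw_def n_def)
    then have "e x = e x'"
      using arg_cong[OF that(3), of "\<lambda>s. s ! e x"] by (simp add: m_def)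
    then show ?thesis using e that by (auto simp: bij_betw_def inj_on_def)
  qed
  have fin: "finite (messages n)"
    unfolding messages_def using finite_lists_length_eq[of "UNIV :: bool set" n] by simp
  have mm: "m x \<in> messages n" for x by (simp add: m_def messages_def)
  have sum: "(\<Sum>s\<in>messages n. pmf (return_pmf (m x)) s * g y s) = g y (m x)" for x y
    using fin mm[of x]
    by (simp add: indicator_def if_distrib[of "\<lambda>u. u * _"] cong: if_cong)
  have "is_protocol X Y n (\<lambda>x. return_pmf (m x)) g"
    using mm by (auto simp: is_protocol_def g_def)
  moreover have "computes n (\<lambda>x. return_pmf (m x)) g f"
    unfolding computes_def
  proof (intro allI impI)
    fix x y assume d: "(x, y) \<in> dom f"
    then obtain b where b: "f (x, y) = Some b" by auto
    have x: "x \<in> X" using d assms by auto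
    have "(\<exists>x'\<in>X. m x' = m x \<and> f (x', y) = Some True) \<longleftrightarrow> f (x, y) = Some True"
      using inj[OF _ x] x by metis
    then have "g y (m x) = (if b then 0 else 1)"
      using b by (simp add: g_def)
    then show "1 / 2 < output_prob n (\<lambda>x. return_pmf (m x)) g x y (the (f (x, y)))"
      using b sum[of x y] by (simp add: output_prob_def)
  qed
  ultimately show ?thesis by blast
qed

lemma ex_arrangement:
  fixes f :: "'a \<times> 'b \<rightharpoonup> bool"
  assumes "finite X" and "dom f \<subseteq> X \<times> Y"
  shows "\<exists>k p h. realizes k p h f"
proof -
  obtain e :: "'a \<Rightarrow> nat" where e: "bij_betw e X {1..card X}"
    using assms(1) ex_bij_betw_nat_finite_1[OF assms(1)] bij_betw_inv by blast
  define k where "k = card X"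
  define p where "p x i = (if i = e x then 1 else 0 :: real)" for x i
  define h where "h y i = (if i = k + 1 then 0
      else if f (inv_into X e i, y) = Some True then - 1 else 1 :: real)" for y i
  have "realizes k p h f"
    unfolding realizes_def
  proof (intro allI impI)
    fix x y assume d: "(x, y) \<in> dom f"
    then obtain b where b: "f (x, y) = Some b" by auto
    have x: "x \<in> X" using d assms by auto
    have ex: "e x \<in> {1..k}" using e x by (auto simp: bij_betw_def k_def)
    have "(\<Sum>i=1..k. p x i * h y i) = h y (e x)"
      using ex by (simp add: p_def if_distrib[of "\<lambda>u. u * _"] cong: if_cong)
    moreover have "h y (e x) = (if b then - 1 else 1)"
      using ex e x b by (auto simp: h_def bij_betw_def)
    ultimately show "side k (p x) (h y) = (-1) ^ of_bool (the (f (x, y)))"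
      using b by (simp add: side_def h_def)
  qed
  then show ?thesis by blast
qed

end

(* Both directions rest on one observation: Bob's advantage
   (probability of output 0) - 1/2 equals the sum over s of q_x(s) * (l_y(s) - 1/2), which is an
   affine function of the 2^n - 1 free coordinates of the probability vector q_x.  Hence a protocol
   of cost n is an arrangement in dimension 2^n - 1 whose points lie in the standard simplex.
   Conversely, finitely many points can be moved into the simplex by a translation and a
   homothety, and the hyperplanes can be rescaled so that their coefficients lie in [-1/2, 1/2]. *)
theory Submission
  imports Defs
begin

lemma finite_messages: "finite (messages n)"
  unfolding messages_def using finite_lists_length_eq[of "UNIV :: bool set" n] by simp

lemma card_messages: "card (messages n) = 2 ^ n"
  unfolding messages_def using card_lists_length_eq[of "UNIV :: bool set" n] by simp

text \<open>Numbers the messages so that the first \<open>k\<close> probabilities serve as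
  coordinates, while the last one, at \<open>k + 1\<close>, is determined by them.\<close>

lemma bij_betw_messages:
  fixes k :: nat
  assumes "k + 1 = 2 ^ n"
  obtains e where "bij_betw e {1..k + 1} (messages n)"
  using finite_same_card_bij[OF _ finite_messages, of "{1..k + 1}" n] assms
  by (auto simp: card_messages)

text \<open>The probabilities sum to 1, so lowering every \<open>l y s\<close> by 1/2 lowers the
  probability of output 0 by 1/2. Output 0 is then favoured when the sum is positive, output 1 when
  it is negative.\<close>

lemma output_prob_gt_half_iff:
  assumes "set_pmf (q x) \<subseteq> messages n"
  shows "output_prob n q l x y b > 1 / 2 \<longleftrightarrow>
    sgn (\<Sum>s\<in>messages n. pmf (q x) s * (l y s - 1 / 2)) = (-1) ^ of_bool b"
proof -
  have "(\<Sum>s\<in>messages n. pmf (q x) s) = 1"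
    using assms by (intro sum_pmf_eq_1 finite_messages)
  then have "(\<Sum>s\<in>messages n. pmf (q x) s * (l y s - 1 / 2)) =
      (\<Sum>s\<in>messages n. pmf (q x) s * l y s) - 1 / 2"
    by (simp add: right_diff_distrib sum_subtractf flip: sum_divide_distrib)
  then show ?thesis
    by (auto simp: output_prob_def sgn_if)
qed

lemma realizes_mono:
  assumes "realizes k p h f" and "k \<le> k'"
  shows "\<exists>p h. realizes k' p h f"
proof -
  \<comment> \<open>The new normal coordinates are 0, so whatever \<open>p\<close> holds beyond
    \<open>k\<close> does no harm; the threshold moves from position \<open>k + 1\<close> to
    \<open>k' + 1\<close>.\<close>
  define h' where
    "h' y i = (if i \<le> k then h y i else if i = k' + 1 then h y (k + 1) else 0)" for y i
  have "(\<Sum>i=1..k'. p x i * h' y i) = (\<Sum>i=1..k. p x i * h y i)" for x y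
    using assms(2) by (intro sum.mono_neutral_cong_right) (auto simp: h'_def)
  then have "side k' (p x) (h' y) = side k (p x) (h y)" for x y
    using assms(2) by (simp add: side_def h'_def)
  then have "realizes k' p h' f"
    using assms(1) by (simp add: realizes_def)
  then show ?thesis by blast
qed

lemma realizes_of_protocol:
  assumes "dom f \<subseteq> X \<times> Y" and "is_protocol X Y n q l" and "computes n q l f"
    and k: "k + 1 = 2 ^ n"
  shows "\<exists>p h. realizes k p h f"
proof -
  obtain e where e: "bij_betw e {1..k + 1} (messages n)"
    using bij_betw_messages[OF k] .
  define p where "p x i = pmf (q x) (e i)" for x i
  \<comment> \<open>Substituting 1 minus the other probabilities for the last one leaves the
    coefficients \<open>l y (e i) - l y (e (k + 1))\<close> and the constant
    \<open>l y (e (k + 1)) - 1 / 2\<close>. The threshold is the negated constant.\<close>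
  define h where "h y i = (if i = k + 1 then 1 / 2 - l y (e i) else l y (e i) - l y (e (k + 1)))"
    for y i
  have "side k (p x) (h y) = (-1) ^ of_bool (the (f (x, y)))" if "(x, y) \<in> dom f" for x y
  proof -
    have q: "set_pmf (q x) \<subseteq> messages n"
      using that assms(1,2) by (auto simp: is_protocol_def)
    have reindex: "(\<Sum>s\<in>messages n. g s) = (\<Sum>i=1..k. g (e i)) + g (e (k + 1))"
      for g :: "_ \<Rightarrow> real"
      using sum.reindex_bij_betw[OF e, of g] by simp
    have one: "pmf (q x) (e (k + 1)) = 1 - (\<Sum>i=1..k. p x i)"
      using sum_pmf_eq_1[OF finite_messages q] reindex[of "pmf (q x)"] by (simp add: p_def)
    have "(\<Sum>s\<in>messages n. pmf (q x) s * (l y s - 1 / 2))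
      = (\<Sum>i=1..k. p x i * (l y (e i) - 1 / 2)) + (1 - (\<Sum>i=1..k. p x i)) * (l y (e (k + 1)) - 1 / 2)"
      by (simp only: reindex one p_def)
    also have "\<dots> = (\<Sum>i=1..k. p x i * h y i) - h y (k + 1)"
      by (simp add: h_def algebra_simps sum.distrib sum_subtractf sum_distrib_left
          flip: sum_divide_distrib)
    finally have "side k (p x) (h y) = sgn (\<Sum>s\<in>messages n. pmf (q x) s * (l y s - 1 / 2))"
      by (simp only: side_def)
    moreover have "1 / 2 < output_prob n q l x y (the (f (x, y)))"
      using assms(3) that unfolding computes_def by blast
    ultimately show ?thesis
      by (simp only: output_prob_gt_half_iff[of q x, OF q])
  qed
  then show ?thesis
    unfolding realizes_def by blast
qed

text \<open>Extending the weights by 0 outside \<open>A\<close> gives a density of total mass 1 on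
  the whole type, and the zeros confine its support to \<open>A\<close>.\<close>

lemma pmf_with_weights:
  assumes "finite A" and "\<And>s. s \<in> A \<Longrightarrow> 0 \<le> w s" and "(\<Sum>s\<in>A. w s) = 1"
  shows "\<exists>q. set_pmf q \<subseteq> A \<and> (\<forall>s\<in>A. pmf q s = w s)"
proof -
  define g where "g s = (if s \<in> A then w s else 0)" for s
  have g: "0 \<le> g s" for s
    using assms(2) by (simp add: g_def)
  have "(\<integral>\<^sup>+ s. ennreal (g s) \<partial>count_space UNIV) = (\<Sum>s\<in>A. ennreal (g s))"
    using assms(1) by (intro nn_integral_count_space') (auto simp: g_def)
  also have "\<dots> = 1"
    using assms(2,3) by (simp add: g_def sum_ennreal cong: sum.cong)
  finally have "pmf (embed_pmf g) s = g s" for s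
    by (intro pmf_embed_pmf g)
  then show ?thesis
    by (intro exI[of _ "embed_pmf g"]) (auto simp: set_pmf_iff g_def split: if_splits)
qed

lemma protocol_of_realizes:
  assumes "finite X" and "dom f \<subseteq> X \<times> Y" and "realizes k p h f" and k: "k + 1 = 2 ^ n"
  shows "\<exists>q l. is_protocol X Y n q l \<and> computes n q l f"
proof -
  obtain e where e: "bij_betw e {1..k + 1} (messages n)"
    using bij_betw_messages[OF k] .
  define e' where "e' = inv_into {1..k + 1} e"
  have e'e: "e' (e i) = i" if "i \<in> {1..k + 1}" for i
    using that e by (simp add: e'_def bij_betw_def)
  have e': "e' s \<in> {1..k + 1}" if "s \<in> messages n" for s
    using that e unfolding e'_def bij_betw_def by (metis inv_into_into)
  have reindex: "(\<Sum>s\<in>messages n. g (e' s) s) = (\<Sum>i=1..k. g i (e i)) + g (k + 1) (e (k + 1))"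
    for g :: "_ \<Rightarrow> _ \<Rightarrow> real"
  proof -
    have "(\<Sum>s\<in>messages n. g (e' s) s) = (\<Sum>i\<in>{1..k + 1}. g (e' (e i)) (e i))"
      using sum.reindex_bij_betw[OF e, of "\<lambda>s. g (e' s) s"] by simp
    also have "\<dots> = (\<Sum>i\<in>{1..k + 1}. g i (e i))"
      by (intro sum.cong) (simp_all add: e'e)
    finally show ?thesis by simp
  qed
  \<comment> \<open>As \<open>X\<close> is finite, \<open>M\<close> bounds every coordinate in
    absolute value, so \<open>p x i + M\<close> lies between 0 and \<open>2 * M\<close>. Division by
    \<open>S\<close> brings the sum of the \<open>k\<close> shifted coordinates to at most 1; the
    summand 1 keeps \<open>S\<close> positive even if \<open>M\<close> or \<open>k\<close> is
    0.\<close>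
  define M where "M = (\<Sum>x\<in>X. \<Sum>i=1..k. \<bar>p x i\<bar>)"
  define S where "S = 2 * M * real k + 1"
  have "0 \<le> M"
    by (simp add: M_def sum_nonneg)
  then have S: "0 < S"
    by (simp add: S_def add_nonneg_pos)
  have bound: "\<bar>p x i\<bar> \<le> M" if "x \<in> X" "i \<in> {1..k}" for x i
  proof -
    have "\<bar>p x i\<bar> \<le> (\<Sum>i=1..k. \<bar>p x i\<bar>)"
      using that(2) by (intro member_le_sum) auto
    also have "\<dots> \<le> M"
      unfolding M_def using that(1) assms(1)
      by (intro member_le_sum[of x X "\<lambda>x. \<Sum>i=1..k. \<bar>p x i\<bar>"]) (auto intro: sum_nonneg)
    finally show ?thesis .
  qed
  \<comment> \<open>The moved point in barycentric form: the last weight is the slack that makes the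
    total 1.\<close>
  define w where "w x i = (if i = k + 1 then 1 - (\<Sum>j=1..k. (p x j + M) / S) else (p x i + M) / S)"
    for x i
  have w_nonneg: "0 \<le> w x i" if "x \<in> X" "i \<in> {1..k + 1}" for x i
  proof (cases "i = k + 1")
    case True
    have "(\<Sum>j=1..k. (p x j + M) / S) \<le> (\<Sum>j=1..k. 2 * M / S)"
      using bound[OF that(1)] S by (intro sum_mono divide_right_mono) (fastforce simp: abs_le_iff)+
    also have "\<dots> = 2 * M * real k / S"
      by simp
    also have "\<dots> \<le> 1"
      using S by (simp add: S_def divide_le_eq)
    finally show ?thesis
      using True by (simp add: w_def)
  next
    case False
    then have "- p x i \<le> M"
      using bound[OF that(1), of i] that(2) by auto
    then show ?thesis
      using False S by (simp add: w_def)
  qed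
  have "\<exists>q. set_pmf q \<subseteq> messages n \<and> (\<forall>s\<in>messages n. pmf q s = w x (e' s))" if "x \<in> X" for x
    using w_nonneg[OF that] e' reindex[of "\<lambda>i _. w x i"]
    by (intro pmf_with_weights finite_messages) (auto simp: w_def)
  then have "\<forall>x\<in>X. \<exists>q. set_pmf q \<subseteq> messages n \<and> (\<forall>s\<in>messages n. pmf q s = w x (e' s))"
    by blast
  from bchoice[OF this] obtain q where
      q: "\<And>x. x \<in> X \<Longrightarrow> set_pmf (q x) \<subseteq> messages n"
      and pmf_q: "\<And>x s. x \<in> X \<Longrightarrow> s \<in> messages n \<Longrightarrow> pmf (q x) s = w x (e' s)"
    by blast
  \<comment> \<open>If u is the moved point, then p = S u - M in each coordinate, and the affine
    form of \<open>h y\<close> at p becomes S times the inner product of u and \<open>h y\<close>,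
    minus \<open>c y\<close>. Since the weights sum to 1, \<open>c y\<close> can be subtracted from
    every coefficient, which gives the form \<open>v y\<close>, linear in the weights and without a
    threshold.\<close>
  define c where "c y = M * (\<Sum>i=1..k. h y i) + h y (k + 1)" for y
  define v where "v y i = (if i = k + 1 then - c y else S * h y i - c y)" for y i
  \<comment> \<open>Dividing by \<open>2 * B y\<close> puts the coefficients into [-1/2, 1/2] and
    preserves signs; the summand 1 excludes division by 0.\<close>
  define B where "B y = 1 + (\<Sum>i=1..k + 1. \<bar>v y i\<bar>)" for y
  have B: "0 < B y" for y
    unfolding B_def by (intro add_pos_nonneg sum_nonneg) auto
  have v_le: "\<bar>v y i\<bar> \<le> B y" if "i \<in> {1..k + 1}" for y i
    using member_le_sum[of i "{1..k + 1}" "\<lambda>i. \<bar>v y i\<bar>"] that by (simp add: B_def)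
  define l where "l y s = 1 / 2 + v y (e' s) / B y / 2" for y s
  have "0 \<le> l y s \<and> l y s \<le> 1" if "s \<in> messages n" for y s
  proof -
    have "\<bar>v y (e' s) / B y\<bar> \<le> 1"
      using v_le[OF e'[OF that]] B[of y] by simp
    from abs_le_D1[OF this] abs_le_D2[OF this] show ?thesis
      by (simp add: l_def)
  qed
  then have "is_protocol X Y n q l"
    using q by (simp add: is_protocol_def)
  moreover have "computes n q l f"
    unfolding computes_def
  proof (intro allI impI)
    fix x y assume xy: "(x, y) \<in> dom f"
    then have x: "x \<in> X"
      using assms(2) by auto
    have "(p x i + M) / S * (S * h y i) = p x i * h y i + M * h y i" for i
      using S by (simp add: field_simps)
    then have wS: "(\<Sum>i=1..k. (p x i + M) / S * (S * h y i))
      = (\<Sum>i=1..k. p x i * h y i) + M * (\<Sum>i=1..k. h y i)"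
      by (simp only: sum.distrib sum_distrib_left)
    have "(\<Sum>s\<in>messages n. pmf (q x) s * (l y s - 1 / 2))
      = (\<Sum>s\<in>messages n. w x (e' s) * v y (e' s)) / (2 * B y)"
      using pmf_q[OF x] by (simp add: l_def sum_divide_distrib mult.commute)
    also have "(\<Sum>s\<in>messages n. w x (e' s) * v y (e' s))
      = (\<Sum>i=1..k. w x i * v y i) + w x (k + 1) * v y (k + 1)"
      using reindex[of "\<lambda>i _. w x i * v y i"] .
    also have "\<dots> = (\<Sum>i=1..k. (p x i + M) / S * (S * h y i - c y))
        - (1 - (\<Sum>i=1..k. (p x i + M) / S)) * c y"
      by (simp add: w_def v_def)
    also have "\<dots> = (\<Sum>i=1..k. (p x i + M) / S * (S * h y i)) - c y"
      by (simp only: right_diff_distrib left_diff_distrib sum_subtractf sum_distrib_right)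
    also have "\<dots> = (\<Sum>i=1..k. p x i * h y i) - h y (k + 1)"
      by (simp only: wS) (simp add: c_def)
    finally have "sgn (\<Sum>s\<in>messages n. pmf (q x) s * (l y s - 1 / 2)) = side k (p x) (h y)"
      using B[of y] by (simp add: side_def sgn_divide sgn_mult)
    then show "1 / 2 < output_prob n q l x y (the (f (x, y)))"
      using assms(3) xy unfolding output_prob_gt_half_iff[of q x, OF q[OF x]]
      by (simp add: realizes_def)
  qed
  ultimately show ?thesis by blast
qed

text \<open>Protocols of cost \<open>n\<close> correspond to arrangements of dimension
  \<open>2 ^ n - 1\<close>. Padding makes realizability upward closed in the dimension, so it
  amounts to a bound on the least one.\<close>

lemma ex_protocol_iff:
  assumes "finite X" and "dom f \<subseteq> X \<times> Y"
  shows "(\<exists>q l. is_protocol X Y n q l \<and> computes n q l f) \<longleftrightarrow> arrangement_dim f + 1 \<le> 2 ^ n"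
proof -
  have k: "(2 ^ n - 1) + 1 = (2 ^ n :: nat)"
    by simp
  have "(\<exists>q l. is_protocol X Y n q l \<and> computes n q l f) \<longleftrightarrow> (\<exists>p h. realizes (2 ^ n - 1) p h f)"
    using realizes_of_protocol[OF assms(2) _ _ k] protocol_of_realizes[OF assms _ k] by blast
  also have "\<dots> \<longleftrightarrow> arrangement_dim f \<le> 2 ^ n - 1"
  proof
    assume "\<exists>p h. realizes (2 ^ n - 1) p h f"
    then show "arrangement_dim f \<le> 2 ^ n - 1"
      unfolding arrangement_dim_def by (rule Least_le)
  next
    assume "arrangement_dim f \<le> 2 ^ n - 1"
    moreover have "\<exists>p h. realizes (arrangement_dim f) p h f"
      unfolding arrangement_dim_def using ex_arrangement[OF assms] by (rule LeastI_ex)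
    ultimately show "\<exists>p h. realizes (2 ^ n - 1) p h f"
      using realizes_mono by blast
  qed
  also have "\<dots> \<longleftrightarrow> arrangement_dim f + 1 \<le> 2 ^ n"
    using k by linarith
  finally show ?thesis .
qed

text \<open>Taking logarithms, \<open>m \<le> 2 ^ n\<close> says that \<open>n\<close> is at least
  the ceiling. That ceiling is itself a natural number because \<open>m\<close> is at least 1, so
  the minimum is attained there.\<close>

lemma int_Least_le_power2:
  assumes "0 < m"
  shows "int (LEAST n. m \<le> 2 ^ n) = \<lceil>log 2 (real m)\<rceil>"
proof -
  have iff: "m \<le> 2 ^ n \<longleftrightarrow> \<lceil>log 2 (real m)\<rceil> \<le> int n" for n
  proof -
    have "m \<le> 2 ^ n \<longleftrightarrow> real m \<le> 2 powr real n"
      using of_nat_le_iff[of m "2 ^ n", where 'a = real] by (simp add: powr_realpow)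
    also have "\<dots> \<longleftrightarrow> log 2 (real m) \<le> real n"
      using assms by (simp add: log_le_iff)
    finally show ?thesis
      by (simp add: ceiling_le_iff)
  qed
  have "0 \<le> log 2 (real m)"
    using assms by simp
  then have "0 \<le> \<lceil>log 2 (real m)\<rceil>"
    by linarith
  moreover have "(LEAST n. m \<le> 2 ^ n) = nat \<lceil>log 2 (real m)\<rceil>"
    unfolding iff by (rule Least_equality) (simp_all add: nat_le_iff)
  ultimately show ?thesis
    by simp
qed

theorem theorem4p1:
  fixes X :: "'a set" and Y :: "'b set" and f :: "'a \<times> 'b \<rightharpoonup> bool"
  assumes "finite X" and "X \<noteq> {}" and "finite Y" and "Y \<noteq> {}"
    and "dom f \<subseteq> X \<times> Y"
  shows "int (unbounded_error_cc X Y f) = \<lceil>log 2 (real (arrangement_dim f) + 1)\<rceil>"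
  using int_Least_le_power2[of "arrangement_dim f + 1"]
  by (simp add: unbounded_error_cc_def ex_protocol_iff[OF assms(1,5)] add.commute)

end
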